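(* Fix $\varepsilon=0.01$. Then the randomized query complexity of \textsc{Fourier Sampling} (with error parameter $\varepsilon$) is $\Omega(N/\log N)$, where $N=2^n$.
   Context: \textsc{Fourier Sampling}: given oracle access to a Boolean function $f:\{0,1\}^n\to\{-1,1\}$ (each classical query returns one value $f(x)$), sample from a distribution $D$ over $\{0,1\}^n$ such that $\|D-D_f\|\le\varepsilon$, where $\|\cdot\|$ is total variation distance (half the $\ell_1$ distance) and $D_f$ is the distribution $$\Pr_{D_f}[y]=\hat f(y)^2=\left(\frac{1}{2^n}\sum_{x\in\{0,1\}^n}f(x)(-1)^{x\cdot y}\right)^2.$$ The condition must hold for every $f$. The randomized query complexity is the minimum, over classical randomized algorithms achieving this for all $f$, of the maximum number of queries made. *)

theory Defs
  imports "HOL-Probability.Probability" "HOL-Library.Landau_Symbols"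
begin

definition cube :: "nat \<Rightarrow> bool list set" where
  "cube n = {x. length x = n}"

definition boolean_functions :: "nat \<Rightarrow> (bool list \<Rightarrow> real) set" where
  "boolean_functions n = cube n \<rightarrow>\<^sub>E {-1, 1}"

definition dot :: "bool list \<Rightarrow> bool list \<Rightarrow> nat" where
  "dot x y = card {i. i < length x \<and> i < length y \<and> x ! i \<and> y ! i}"

definition fourier_coeff :: "nat \<Rightarrow> (bool list \<Rightarrow> real) \<Rightarrow> bool list \<Rightarrow> real" where
  "fourier_coeff n f y = (1 / 2 ^ n) * (\<Sum>x\<in>cube n. f x * (-1) ^ dot x y)"

text \<open>The probability mass function of \<open>D\<^sub>f\<close> on the cube; the total mass is 1 by Parseval's identity.\<close>

definition fourier_mass :: "nat \<Rightarrow> (bool list \<Rightarrow> real) \<Rightarrow> bool list \<Rightarrow> real" where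
  "fourier_mass n f y = (fourier_coeff n f y)\<^sup>2"

definition tv_dist :: "nat \<Rightarrow> (bool list \<Rightarrow> real) \<Rightarrow> (bool list \<Rightarrow> real) \<Rightarrow> real" where
  "tv_dist n p q = (1 / 2) * (\<Sum>y\<in>cube n. \<bar>p y - q y\<bar>)"

text \<open>Deterministic query algorithms are decision trees; a node \<open>Query x l r\<close> queries the
  oracle at \<open>x\<close> and continues with \<open>l\<close> on answer \<open>-1\<close> and with \<open>r\<close> on answer \<open>1\<close>.\<close>

datatype (query_points: 'q, output_values: 'r) dtree =
    Output 'r
  | Query 'q "('q, 'r) dtree" "('q, 'r) dtree"

primrec run :: "('q, 'r) dtree \<Rightarrow> ('q \<Rightarrow> real) \<Rightarrow> 'r" where
  "run (Output z) f = z"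
| "run (Query x l r) f = (if f x = 1 then run r f else run l f)"

primrec num_queries :: "('q, 'r) dtree \<Rightarrow> ('q \<Rightarrow> real) \<Rightarrow> nat" where
  "num_queries (Output z) f = 0"
| "num_queries (Query x l r) f = Suc (if f x = 1 then num_queries r f else num_queries l f)"

text \<open>A randomized algorithm is a probability distribution over deterministic ones. Discrete
  distributions lose no generality: up to repeated queries of the same point, there are only
  finitely many decision trees over the cube.\<close>

definition randomized_algorithm :: "nat \<Rightarrow> (bool list, bool list) dtree pmf \<Rightarrow> bool" where
  "randomized_algorithm n A \<longleftrightarrow>
     (\<forall>t\<in>set_pmf A. query_points t \<subseteq> cube n \<and> output_values t \<subseteq> cube n)"

definition output_dist :: "('q, 'r) dtree pmf \<Rightarrow> ('q \<Rightarrow> real) \<Rightarrow> 'r pmf" where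
  "output_dist A f = map_pmf (\<lambda>t. run t f) A"

definition solves_fourier_sampling ::
  "real \<Rightarrow> nat \<Rightarrow> (bool list, bool list) dtree pmf \<Rightarrow> bool" where
  "solves_fourier_sampling \<epsilon> n A \<longleftrightarrow>
     (\<forall>f\<in>boolean_functions n. tv_dist n (pmf (output_dist A f)) (fourier_mass n f) \<le> \<epsilon>)"

definition makes_at_most :: "nat \<Rightarrow> (bool list, bool list) dtree pmf \<Rightarrow> nat \<Rightarrow> bool" where
  "makes_at_most n A q \<longleftrightarrow>
     (\<forall>t\<in>set_pmf A. \<forall>f\<in>boolean_functions n. num_queries t f \<le> q)"

text \<open>For \<open>\<epsilon> \<ge> 0\<close> the minimum is over a nonempty set: with \<open>2 ^ n\<close> queries an algorithm learns
  \<open>f\<close> completely and can sample from \<open>D\<^sub>f\<close> exactly.\<close>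

definition fourier_sampling_complexity :: "real \<Rightarrow> nat \<Rightarrow> nat" where
  "fourier_sampling_complexity \<epsilon> n =
     (LEAST q. \<exists>A. randomized_algorithm n A \<and> solves_fourier_sampling \<epsilon> n A \<and> makes_at_most n A q)"

end

theory Submission
  imports Defs
begin

text \<open>Let \<open>f\<close> be uniformly random and \<open>Z y = (\<Sum>x. f x * (-1) ^ dot x y) / sqrt N\<close>, so that
  \<open>D\<^sub>f\<close> has mass \<open>(Z y)\<^sup>2 / N\<close> at \<open>y\<close>. If \<open>y\<close> is drawn from \<open>D\<^sub>f\<close>, then \<open>Z y\<close> follows a
  size-biased, nearly Gaussian law: the mean of \<open>(Z y)\<^sup>2\<close> is about 3, and the mean of
  \<open>min ((Z y)\<^sup>2) 4\<close> is at least \<open>E Z\<^sup>4 - E Z\<^sup>6 / 16 \<ge> 25/16\<close>. After \<open>q\<close> queries, on the other hand, the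
  revealed part of every sum \<open>Z y\<close> has square \<open>O(q log N / N)\<close>, and the unrevealed part is
  independent of the output and adds variance at most 1. So if \<open>q\<close> is a small multiple of
  \<open>N / log N\<close>, the output \<open>y\<close> satisfies \<open>E (Z y)\<^sup>2 \<le> 5/4\<close>, which is incompatible with total
  variation distance \<open>0.01\<close>.\<close>

section \<open>Sums over sign functions\<close>

text \<open>\<open>X\<close> holds the points not yet revealed and \<open>f0\<close> records the
  values elsewhere, so the functions consistent with the answers seen so far by a decision tree
  again form such a family. With \<open>X = cube n\<close> and \<open>undefined\<close> elsewhere it
  is \<open>boolean_functions n\<close>.\<close>

definition sign_extensions :: "'a set \<Rightarrow> ('a \<Rightarrow> real) \<Rightarrow> ('a \<Rightarrow> real) set" where
  "sign_extensions X f0 = {f. (\<forall>x\<in>X. f x \<in> {-1, 1}) \<and> (\<forall>x. x \<notin> X \<longrightarrow> f x = f0 x)}"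

lemma sign_extensions_empty [simp]: "sign_extensions {} f0 = {f0}"
  by (auto simp: sign_extensions_def)

lemma sign_extensions_outside:
  "f \<in> sign_extensions X f0 \<Longrightarrow> x \<notin> X \<Longrightarrow> f x = f0 x"
  by (simp add: sign_extensions_def)

lemma sign_extensions_insert:
  assumes "x \<notin> X"
  shows "sign_extensions (insert x X) f0 =
    sign_extensions X (f0(x := 1)) \<union> sign_extensions X (f0(x := -1))"
proof (intro equalityI subsetI)
  fix f assume "f \<in> sign_extensions (insert x X) f0"
  then show "f \<in> sign_extensions X (f0(x := 1)) \<union> sign_extensions X (f0(x := -1))"
    by (cases "f x = 1") (auto simp: sign_extensions_def)
next
  fix f assume "f \<in> sign_extensions X (f0(x := 1)) \<union> sign_extensions X (f0(x := -1))"
  then show "f \<in> sign_extensions (insert x X) f0"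
    using assms by (auto simp: sign_extensions_def split: if_splits)
qed

lemma sign_extensions_disjoint:
  assumes "x \<notin> X"
  shows "sign_extensions X (f0(x := 1)) \<inter> sign_extensions X (f0(x := -1)) = {}"
proof -
  have False if "f \<in> sign_extensions X (f0(x := 1))" "f \<in> sign_extensions X (f0(x := -1))" for f
    using sign_extensions_outside[OF that(1) assms] sign_extensions_outside[OF that(2) assms] by simp
  then show ?thesis by blast
qed

lemma finite_sign_extensions [simp]: "finite X \<Longrightarrow> finite (sign_extensions X f0)"
  by (induction X arbitrary: f0 rule: finite_induct) (auto simp: sign_extensions_insert)

lemma sum_sign_extensions_insert:
  assumes "finite X" "x \<notin> X"
  shows "sum F (sign_extensions (insert x X) f0) =
    sum F (sign_extensions X (f0(x := 1))) + sum F (sign_extensions X (f0(x := -1)))"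
  unfolding sign_extensions_insert[OF assms(2)]
  by (rule sum.union_disjoint) (use assms(1) sign_extensions_disjoint[OF assms(2)] in simp_all)

lemma card_sign_extensions: "finite X \<Longrightarrow> card (sign_extensions X f0) = 2 ^ card X"
proof (induction X arbitrary: f0 rule: finite_induct)
  case (insert x X)
  then show ?case
    using sum_sign_extensions_insert[OF insert.hyps, of "\<lambda>_. 1::nat" f0] by simp
qed simp

lemma boolean_functions_eq_sign_extensions:
  "boolean_functions n = sign_extensions (cube n) (\<lambda>_. undefined)"
  by (auto simp: boolean_functions_def sign_extensions_def PiE_def Pi_def extensional_def)

text \<open>The recursion step shared by the moment computations. Fixing the sign at
  \<open>x\<close> shifts the start \<open>c\<close> by \<open>a x\<close> or \<open>- a x\<close>;
  as \<open>a x\<close> is itself a sign, these are \<open>1\<close> and \<open>-1\<close> in some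
  order. \<open>M\<close> must not depend on \<open>f0\<close>, since the two halves of the family
  differ in \<open>f0\<close>.\<close>

lemma sum_sign_extensions_walk_insert:
  fixes \<phi> :: "real \<Rightarrow> real"
  assumes "finite X" "x \<notin> X" "\<bar>a x :: real\<bar> = 1"
    and "\<And>f0 c. (\<Sum>f\<in>sign_extensions X f0. \<phi> (c + (\<Sum>x\<in>X. f x * a x))) = M c"
  shows "(\<Sum>f\<in>sign_extensions (insert x X) f0. \<phi> (c + (\<Sum>x\<in>insert x X. f x * a x))) =
    M (c + 1) + M (c - 1)"
proof -
  have *: "(\<Sum>f\<in>sign_extensions X (f0(x := s)). \<phi> (c + (\<Sum>x\<in>insert x X. f x * a x))) =
      M (c + s * a x)" for s :: real
    unfolding assms(4)[of "c + s * a x" "f0(x := s)", symmetric]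
  proof (intro sum.cong refl arg_cong[of _ _ \<phi>])
    fix f assume "f \<in> sign_extensions X (f0(x := s))"
    then have "f x = s" using assms(2) by (simp add: sign_extensions_def)
    then show "c + (\<Sum>x\<in>insert x X. f x * a x) = c + s * a x + (\<Sum>x\<in>X. f x * a x)"
      using assms(1,2) by simp
  qed
  have "a x = 1 \<or> a x = -1" using assms(3) by linarith
  then show ?thesis
    unfolding sum_sign_extensions_insert[OF assms(1,2)] * by auto
qed

text \<open>The start \<open>c\<close> is general because the induction shifts it; at the leaf of a
  decision tree \<open>c\<close> is the revealed part of a character sum.\<close>

lemma sign_walk_moment2:
  assumes "finite X" "\<And>x. x \<in> X \<Longrightarrow> \<bar>a x\<bar> = 1"
  shows "(\<Sum>f\<in>sign_extensions X f0. (c + (\<Sum>x\<in>X. f x * a x))\<^sup>2) =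
    2 ^ card X * (c\<^sup>2 + real (card X))"
  using assms
proof (induction X arbitrary: f0 c rule: finite_induct)
  case (insert x X)
  have "(\<Sum>f\<in>sign_extensions (insert x X) f0. (c + (\<Sum>x\<in>insert x X. f x * a x))\<^sup>2) =
     2 ^ card X * ((c + 1)\<^sup>2 + real (card X)) + 2 ^ card X * ((c - 1)\<^sup>2 + real (card X))"
    by (rule sum_sign_extensions_walk_insert) (use insert in auto)
  also have "\<dots> = 2 ^ card (insert x X) * (c\<^sup>2 + real (card (insert x X)))"
    using insert.hyps by simp algebra
  finally show ?case .
qed simp

text \<open>The polynomial solves \<open>p (m + 1) c = (p m (c + 1) + p m (c - 1)) / 2\<close> with
  \<open>p 0 c = c ^ 4\<close>. At \<open>c = 0\<close> it is the fourth moment of simple random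
  walk.\<close>

lemma sign_walk_moment4:
  assumes "finite X" "\<And>x. x \<in> X \<Longrightarrow> \<bar>a x\<bar> = 1"
  defines "m \<equiv> real (card X)"
  shows "(\<Sum>f\<in>sign_extensions X f0. (c + (\<Sum>x\<in>X. f x * a x)) ^ 4) =
    2 ^ card X * (c ^ 4 + 6 * c\<^sup>2 * m + 3 * m\<^sup>2 - 2 * m)"
  using assms(1,2) unfolding m_def
proof (induction X arbitrary: f0 c rule: finite_induct)
  case (insert x X)
  let ?p = "\<lambda>c. 2 ^ card X * (c ^ 4 + 6 * c\<^sup>2 * real (card X) + 3 * (real (card X))\<^sup>2
    - 2 * real (card X))"
  have "(\<Sum>f\<in>sign_extensions (insert x X) f0. (c + (\<Sum>x\<in>insert x X. f x * a x)) ^ 4) =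
     ?p (c + 1) + ?p (c - 1)"
    by (rule sum_sign_extensions_walk_insert) (use insert in auto)
  also have "\<dots> = 2 ^ card (insert x X) * (c ^ 4 + 6 * c\<^sup>2 * real (card (insert x X))
      + 3 * (real (card (insert x X)))\<^sup>2 - 2 * real (card (insert x X)))"
    using insert.hyps by simp algebra
  finally show ?case .
qed simp

text \<open>The same recursion, now started from \<open>c ^ 6\<close>.\<close>

lemma sign_walk_moment6:
  assumes "finite X" "\<And>x. x \<in> X \<Longrightarrow> \<bar>a x\<bar> = 1"
  defines "m \<equiv> real (card X)"
  shows "(\<Sum>f\<in>sign_extensions X f0. (c + (\<Sum>x\<in>X. f x * a x)) ^ 6) =
    2 ^ card X * (c ^ 6 + 15 * c ^ 4 * m + 15 * c\<^sup>2 * (3 * m\<^sup>2 - 2 * m)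
      + 15 * m ^ 3 - 30 * m\<^sup>2 + 16 * m)"
  using assms(1,2) unfolding m_def
proof (induction X arbitrary: f0 c rule: finite_induct)
  case (insert x X)
  let ?q = "\<lambda>m c. c ^ 6 + 15 * c ^ 4 * m + 15 * c\<^sup>2 * (3 * m\<^sup>2 - 2 * m)
      + 15 * m ^ 3 - 30 * m\<^sup>2 + 16 * m"
  let ?p = "\<lambda>c. 2 ^ card X * ?q (real (card X)) c"
  have "(\<Sum>f\<in>sign_extensions (insert x X) f0. (c + (\<Sum>x\<in>insert x X. f x * a x)) ^ 6) =
     ?p (c + 1) + ?p (c - 1)"
    by (rule sum_sign_extensions_walk_insert) (use insert in auto)
  also have "\<dots> = 2 ^ card (insert x X) * ?q (real (card (insert x X))) c"
    using insert.hyps by simp algebra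
  finally show ?case .
qed simp

section \<open>Decision trees cannot find large character sums\<close>

text \<open>Termwise comparison of the power series, using
  \<open>2 ^ n * fact n \<le> fact (2 * n)\<close>. It is the sub-Gaussian bound on the moment
  generating function of a random sign.\<close>

lemma cosh_le_exp_half_square:
  fixes x :: real
  shows "cosh x \<le> exp (x\<^sup>2 / 2)"
proof -
  have fact_ge: "2 ^ n * fact n \<le> (fact (2 * n) :: real)" for n
  proof (induction n)
    case (Suc n)
    have "2 ^ Suc n * fact (Suc n) = 2 * real (Suc n) * (2 ^ n * fact n)" by simp
    also have "\<dots> \<le> (2 * real (Suc n) * real (2 * n + 1)) * fact (2 * n)"
      using Suc by (intro mult_mono) (auto simp: algebra_simps)
    also have "\<dots> = fact (2 * Suc n)" by (simp add: algebra_simps)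
    finally show ?case .
  qed simp
  let ?c = "\<lambda>n. if even n then x ^ n /\<^sub>R fact n else 0"
  have "?c sums cosh x" by (rule cosh_converges)
  then have "(\<lambda>n. ?c (2 * n)) sums cosh x"
    by (subst sums_mono_reindex) (auto simp: strict_mono_def image_iff elim!: evenE)
  moreover have "(\<lambda>n. (x\<^sup>2 / 2) ^ n /\<^sub>R fact n) sums exp (x\<^sup>2 / 2)"
    by (rule exp_converges)
  moreover have "?c (2 * n) \<le> (x\<^sup>2 / 2) ^ n /\<^sub>R fact n" for n
  proof -
    have "x ^ (2 * n) / fact (2 * n) \<le> x ^ (2 * n) / (2 ^ n * fact n)"
      using fact_ge[of n] by (intro divide_left_mono) (auto simp: power_mult)
    also have "x ^ (2 * n) / (2 ^ n * fact n) = (x\<^sup>2 / 2) ^ n / fact n"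
      by (simp add: power_divide power_mult)
    finally show ?thesis
      by (simp only: real_scaleR_def divide_inverse mult.commute even_mult_iff even_numeral
          simp_thms if_True)
  qed
  ultimately show ?thesis by (rule sums_le[rotated])
qed

text \<open>Up to the threshold \<open>\<theta> * \<bar>s\<bar> = \<tau>\<close> the first term
  suffices. Beyond it the exponential outgrows the square, and the factor
  \<open>exp (- \<tau>)\<close> makes the price small even after summing \<open>cosh\<close> over
  many candidates.\<close>

lemma square_le_cosh:
  fixes s \<theta> \<tau> :: real
  assumes "\<theta> > 0" "\<tau> \<ge> 2"
  shows "s\<^sup>2 \<le> \<tau>\<^sup>2 / \<theta>\<^sup>2 + 2 * \<tau>\<^sup>2 / \<theta>\<^sup>2 * exp (- \<tau>) * cosh (\<theta> * s)"
proof -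
  define u where "u = \<theta> * \<bar>s\<bar>"
  have u: "u \<ge> 0" "u\<^sup>2 = \<theta>\<^sup>2 * s\<^sup>2" using assms by (auto simp: u_def power_mult_distrib)
  have cosh: "cosh (\<theta> * s) = cosh u"
    by (cases "s \<ge> 0") (simp_all add: u_def)
  have "u\<^sup>2 \<le> \<tau>\<^sup>2 + \<tau>\<^sup>2 * exp (u - \<tau>)"
  proof (cases "u \<le> \<tau>")
    case True
    then have "u\<^sup>2 \<le> \<tau>\<^sup>2" using u by (intro power_mono) auto
    then show ?thesis by (simp add: add_increasing2)
  next
    case False
    have "u / \<tau> = 1 + (u - \<tau>) / \<tau>" using assms by (simp add: field_simps)
    \<comment> \<open>Here \<open>\<tau> \<ge> 2\<close> enters; it gives the exponent one half,
      which squaring turns into \<open>u - \<tau>\<close>.\<close>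
    also have "\<dots> \<le> 1 + (u - \<tau>) / 2"
      using False assms by (intro add_left_mono divide_left_mono) auto
    also have "\<dots> \<le> exp ((u - \<tau>) / 2)" by (rule exp_ge_add_one_self)
    finally have "u \<le> \<tau> * exp ((u - \<tau>) / 2)" using assms by (simp add: field_simps)
    then have "u\<^sup>2 \<le> (\<tau> * exp ((u - \<tau>) / 2))\<^sup>2" using u by (intro power_mono) auto
    also have "\<dots> = \<tau>\<^sup>2 * exp (u - \<tau>)"
      by (simp add: power_mult_distrib exp_double[symmetric])
    finally show ?thesis by (simp add: add_increasing)
  qed
  also have "exp (u - \<tau>) \<le> 2 * exp (-\<tau>) * cosh u"
    by (simp add: cosh_def exp_diff exp_minus field_simps)
  finally have "\<theta>\<^sup>2 * s\<^sup>2 \<le> \<tau>\<^sup>2 + \<tau>\<^sup>2 * (2 * exp (-\<tau>) * cosh (\<theta> * s))"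
    unfolding u(2)[symmetric] cosh by (simp add: mult_left_mono)
  then show ?thesis using assms by (simp add: field_simps)
qed

text \<open>The potential \<open>\<Sum>y. cosh (\<theta> * S y)\<close>, where \<open>S y\<close> is the part of the sum at \<open>y\<close> that is
  already revealed, grows by at most \<open>exp (\<theta>\<^sup>2 / 2)\<close> per query on average, and it controls
  \<open>(S y)\<^sup>2\<close> for all \<open>y\<close> at once; the unrevealed part adds its variance only.\<close>

lemma sum_square_run_le:
  fixes a :: "'r \<Rightarrow> 'q \<Rightarrow> real" and K \<kappa> \<theta> :: real
  assumes "finite C" "finite Y" "X \<subseteq> C"
    and a: "\<And>x y. x \<in> C \<Longrightarrow> \<bar>a y x\<bar> = 1"
    and K: "\<And>s. s\<^sup>2 \<le> K + \<kappa> * cosh (\<theta> * s)" and \<kappa>: "\<kappa> \<ge> 0"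
    and "output_values t \<subseteq> Y" "\<And>f. f \<in> sign_extensions X f0 \<Longrightarrow> num_queries t f \<le> q"
  shows "(\<Sum>f\<in>sign_extensions X f0. (\<Sum>x\<in>C. f x * a (run t f) x)\<^sup>2) \<le>
    2 ^ card X * (real (card X) + K
      + \<kappa> * (exp (\<theta>\<^sup>2 / 2) ^ q * (\<Sum>y\<in>Y. cosh (\<theta> * (\<Sum>x\<in>C - X. f0 x * a y x)))))"
  using assms(3,7,8)
proof (induction t arbitrary: X f0 q)
  case (Output y)
  have fin: "finite X" using Output(1) assms(1) by (rule finite_subset)
  let ?s = "\<lambda>y. \<Sum>x\<in>C - X. f0 x * a y x"
  have "(\<Sum>f\<in>sign_extensions X f0. (\<Sum>x\<in>C. f x * a y x)\<^sup>2) =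
      (\<Sum>f\<in>sign_extensions X f0. (?s y + (\<Sum>x\<in>X. f x * a y x))\<^sup>2)"
  proof (intro sum.cong refl arg_cong[of _ _ "\<lambda>z. z\<^sup>2"])
    fix f assume f: "f \<in> sign_extensions X f0"
    have "(\<Sum>x\<in>C. f x * a y x) = (\<Sum>x\<in>C - X. f x * a y x) + (\<Sum>x\<in>X. f x * a y x)"
      using Output assms(1) by (simp add: sum.subset_diff)
    also have "(\<Sum>x\<in>C - X. f x * a y x) = ?s y"
      using f by (intro sum.cong) (auto simp: sign_extensions_outside)
    finally show "(\<Sum>x\<in>C. f x * a y x) = ?s y + (\<Sum>x\<in>X. f x * a y x)" .
  qed
  also have "\<dots> = 2 ^ card X * ((?s y)\<^sup>2 + real (card X))"
    by (rule sign_walk_moment2) (use fin a Output in auto)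
  also have "\<dots> \<le> 2 ^ card X * (real (card X) + K
      + \<kappa> * (exp (\<theta>\<^sup>2 / 2) ^ q * (\<Sum>y\<in>Y. cosh (\<theta> * ?s y))))"
  proof (intro mult_left_mono)
    \<comment> \<open>A leaf names one \<open>y\<close>, whose term is dominated by the sum over all
      of \<open>Y\<close>, so it does not matter how adaptively \<open>y\<close> was chosen. Unspent
      queries only enlarge the factor.\<close>
    have "cosh (\<theta> * ?s y) \<le> (\<Sum>y\<in>Y. cosh (\<theta> * ?s y))"
      using Output assms(2) by (intro member_le_sum) auto
    also have "\<dots> \<le> exp (\<theta>\<^sup>2 / 2) ^ q * (\<Sum>y\<in>Y. cosh (\<theta> * ?s y))"
      by (simp add: mult_le_cancel_right1 leD sum_nonneg)
    finally have "\<kappa> * cosh (\<theta> * ?s y) \<le> \<kappa> * \<dots>" using \<kappa> by (rule mult_left_mono)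
    then show "(?s y)\<^sup>2 + real (card X) \<le> real (card X) + K
        + \<kappa> * (exp (\<theta>\<^sup>2 / 2) ^ q * (\<Sum>y\<in>Y. cosh (\<theta> * ?s y)))"
      using K[of "?s y"] by linarith
  qed simp
  finally show ?case by simp
next
  case (Query x l r)
  have fin: "finite X" using Query.prems(1) assms(1) by (rule finite_subset)
  show ?case
  proof (cases "x \<in> X")
    case False
    \<comment> \<open>The answer at \<open>x\<close> is already determined, so the whole family
      follows one branch.\<close>
    let ?b = "if f0 x = 1 then r else l"
    have run: "run (Query x l r) f = run ?b f"
      and num: "num_queries (Query x l r) f = Suc (num_queries ?b f)"
      if "f \<in> sign_extensions X f0" for f
      using that False by (auto simp: sign_extensions_outside)
    have "(\<Sum>f\<in>sign_extensions X f0. (\<Sum>z\<in>C. f z * a (run (Query x l r) f) z)\<^sup>2) =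
       (\<Sum>f\<in>sign_extensions X f0. (\<Sum>z\<in>C. f z * a (run ?b f) z)\<^sup>2)"
      by (intro sum.cong refl) (simp only: run)
    also have "\<dots> \<le> 2 ^ card X * (real (card X) + K
      + \<kappa> * (exp (\<theta>\<^sup>2 / 2) ^ q * (\<Sum>y\<in>Y. cosh (\<theta> * (\<Sum>x\<in>C - X. f0 x * a y x)))))"
    proof -
      have le: "num_queries ?b f \<le> q" if "f \<in> sign_extensions X f0" for f
        using Query.prems(3)[OF that] num[OF that] by simp
      show ?thesis
      proof (cases "f0 x = 1")
        case True
        then show ?thesis using Query.IH(2)[of X f0 q] Query.prems le by simp
      next
        case False
        then show ?thesis using Query.IH(1)[of X f0 q] Query.prems le by simp
      qed
    qed
    finally show ?thesis .
  next
    case True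
    define W where "W = X - {x}"
    have W: "X = insert x W" "x \<notin> W" "finite W" "W \<subseteq> C" "x \<in> C"
      using True fin Query.prems by (auto simp: W_def)
    have card: "card X = Suc (card W)" using W by simp
    have run: "run (Query x l r) f = run r f" "num_queries (Query x l r) f = Suc (num_queries r f)"
      if "f \<in> sign_extensions W (f0(x := 1))" for f
      using sign_extensions_outside[OF that W(2)] by simp_all
    have run': "run (Query x l r) f = run l f" "num_queries (Query x l r) f = Suc (num_queries l f)"
      if "f \<in> sign_extensions W (f0(x := -1))" for f
      using sign_extensions_outside[OF that W(2)] by simp_all
    have sub: "sign_extensions W (f0(x := 1)) \<subseteq> sign_extensions X f0"
      "sign_extensions W (f0(x := -1)) \<subseteq> sign_extensions X f0"
      unfolding W(1) sign_extensions_insert[OF W(2)] by auto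
    \<comment> \<open>Any member of the family serves to show \<open>q > 0\<close>, since its run
      makes at least this query.\<close>
    obtain f where f: "f \<in> sign_extensions W (f0(x := 1))"
      using card_sign_extensions[OF W(3), of "f0(x := 1)"] by fastforce
    then obtain p where q: "q = Suc p"
      using Query.prems(3)[of f] sub(1) run(2)[OF f] by (cases q) auto
    let ?E = "exp (\<theta>\<^sup>2 / 2)"
    let ?s = "\<lambda>y. \<Sum>x\<in>C - X. f0 x * a y x"
    let ?\<Phi> = "\<lambda>\<sigma>. \<Sum>y\<in>Y. cosh (\<theta> * (\<sigma> * a y x + ?s y))"
    have upd: "(\<Sum>z\<in>C - W. (f0(x := \<sigma>)) z * a y z) = \<sigma> * a y x + ?s y" for \<sigma> y
    proof -
      have "C - W = insert x (C - X)" using W by auto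
      moreover have "x \<notin> C - X" using W by auto
      moreover have "(\<Sum>z\<in>C - X. (f0(x := \<sigma>)) z * a y z) = ?s y"
        using W by (intro sum.cong) auto
      ultimately show ?thesis using assms(1) by simp
    qed
    \<comment> \<open>Averaging over the answer:
      \<open>cosh (v + u) + cosh (v - u) = 2 * cosh u * cosh v\<close>, where
      \<open>u = \<theta> * a y x\<close> has absolute value \<open>\<bar>\<theta>\<bar>\<close> for
      every \<open>y\<close>.\<close>
    have \<Phi>: "(?\<Phi> 1 + ?\<Phi> (-1)) / 2 \<le> ?E * (\<Sum>y\<in>Y. cosh (\<theta> * ?s y))"
    proof -
      have "cosh (\<theta> * (1 * a y x + ?s y)) + cosh (\<theta> * (-1 * a y x + ?s y)) \<le>
          2 * ?E * cosh (\<theta> * ?s y)" for y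
      proof -
        have "cosh (\<theta> * (1 * a y x + ?s y)) + cosh (\<theta> * (-1 * a y x + ?s y)) =
            2 * cosh (\<theta> * a y x) * cosh (\<theta> * ?s y)"
          using cosh_add[of "\<theta> * a y x" "\<theta> * ?s y"] cosh_add[of "- (\<theta> * a y x)" "\<theta> * ?s y"]
          by (simp add: algebra_simps)
        also have "\<dots> \<le> 2 * ?E * cosh (\<theta> * ?s y)"
        proof (intro mult_right_mono mult_left_mono)
          have "(\<theta> * a y x)\<^sup>2 = \<theta>\<^sup>2"
            using a[OF W(5), of y] by (simp add: power_mult_distrib abs_square_eq_1)
          then show "cosh (\<theta> * a y x) \<le> ?E"
            using cosh_le_exp_half_square[of "\<theta> * a y x"] by simp
        qed auto
        finally show ?thesis .
      qed
      then have "?\<Phi> 1 + ?\<Phi> (-1) \<le> (\<Sum>y\<in>Y. 2 * ?E * cosh (\<theta> * ?s y))"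
        unfolding sum.distrib[symmetric] by (rule sum_mono)
      then show ?thesis by (simp add: sum_distrib_left[symmetric])
    qed
    have "(\<Sum>f\<in>sign_extensions X f0. (\<Sum>z\<in>C. f z * a (run (Query x l r) f) z)\<^sup>2) =
       (\<Sum>f\<in>sign_extensions W (f0(x := 1)). (\<Sum>z\<in>C. f z * a (run r f) z)\<^sup>2) +
       (\<Sum>f\<in>sign_extensions W (f0(x := -1)). (\<Sum>z\<in>C. f z * a (run l f) z)\<^sup>2)"
      unfolding W(1) sum_sign_extensions_insert[OF W(3,2)]
      by (intro arg_cong2[of _ _ _ _ "(+)"] sum.cong refl) (simp_all only: run run')
    also have "\<dots> \<le> 2 ^ card W * (real (card W) + K + \<kappa> * (?E ^ p * ?\<Phi> 1))
        + 2 ^ card W * (real (card W) + K + \<kappa> * (?E ^ p * ?\<Phi> (-1)))"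
    proof (rule add_mono)
      have "num_queries r f \<le> p" if "f \<in> sign_extensions W (f0(x := 1))" for f
        using Query.prems(3)[of f] run(2)[OF that] sub that q by auto
      then show "(\<Sum>f\<in>sign_extensions W (f0(x := 1)). (\<Sum>z\<in>C. f z * a (run r f) z)\<^sup>2) \<le>
        2 ^ card W * (real (card W) + K + \<kappa> * (?E ^ p * ?\<Phi> 1))"
        using Query.prems(2) W(4)
        by (intro Query.IH(2)[of W "f0(x := 1)" p, unfolded upd])
          (auto simp del: fun_upd_apply)
      have "num_queries l f \<le> p" if "f \<in> sign_extensions W (f0(x := -1))" for f
        using Query.prems(3)[of f] run'(2)[OF that] sub that q by auto
      then show "(\<Sum>f\<in>sign_extensions W (f0(x := -1)). (\<Sum>z\<in>C. f z * a (run l f) z)\<^sup>2) \<le>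
        2 ^ card W * (real (card W) + K + \<kappa> * (?E ^ p * ?\<Phi> (-1)))"
        using Query.prems(2) W(4)
        by (intro Query.IH(1)[of W "f0(x := -1)" p, unfolded upd])
          (auto simp del: fun_upd_apply)
    qed
    \<comment> \<open>The halves have \<open>2 ^ card W\<close> members each, so the two bounds
      combine into \<open>2 ^ card X\<close> times their average.\<close>
    also have "\<dots> = 2 ^ card X * (real (card W) + K + \<kappa> * (?E ^ p * ((?\<Phi> 1 + ?\<Phi> (-1)) / 2)))"
      by (simp add: card field_simps)
    also have "\<dots> \<le> 2 ^ card X * (real (card X) + K
        + \<kappa> * (?E ^ p * (?E * (\<Sum>y\<in>Y. cosh (\<theta> * ?s y)))))"
      using \<Phi> \<kappa> by (intro mult_left_mono add_mono) (auto simp: card)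
    finally show ?thesis by (simp add: q mult_ac)
  qed
qed

lemma run_in_output_values: "run t f \<in> output_values t"
  by (induction t) auto

section \<open>The cube\<close>

lemma finite_cube [simp]: "finite (cube n)"
  and card_cube: "card (cube n) = 2 ^ n"
  using finite_lists_length_eq[of "UNIV :: bool set" n] card_lists_length_eq[of "UNIV :: bool set" n]
  by (simp_all add: cube_def)

lemma sum_cube_Suc:
  "sum F (cube (Suc n)) = (\<Sum>x\<in>cube n. F (True # x)) + (\<Sum>x\<in>cube n. F (False # x))"
proof -
  have "cube (Suc n) = (#) True ` cube n \<union> (#) False ` cube n"
    by (auto simp: cube_def length_Suc_conv)
  then have "sum F (cube (Suc n)) = sum F ((#) True ` cube n) + sum F ((#) False ` cube n)"
    by (simp only:) (rule sum.union_disjoint, auto)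
  then show ?thesis by (simp add: sum.reindex)
qed

lemma dot_Cons: "dot (b # x) (c # y) = (if b \<and> c then 1 else 0) + dot x y"
proof -
  let ?I = "\<lambda>x y. {i. i < length x \<and> i < length y \<and> x ! i \<and> y ! i}"
  have "?I (b # x) (c # y) = (if b \<and> c then {0} else {}) \<union> Suc ` ?I x y"
  proof (rule set_eqI)
    fix i
    show "i \<in> ?I (b # x) (c # y) \<longleftrightarrow> i \<in> (if b \<and> c then {0} else {}) \<union> Suc ` ?I x y"
      by (cases i) auto
  qed
  moreover have "finite (?I x y)" by simp
  ultimately show ?thesis
    by (simp add: dot_def card_Un_disjoint card_image)
qed

text \<open>Parseval by induction on \<open>n\<close>. Splitting off the first bit of
  \<open>x\<close> gives two half sums; the first bit of \<open>y\<close> decides the sign of the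
  one with \<open>True\<close>, and the parallelogram law removes the cross terms.\<close>

lemma sum_square_character_sums:
  "(\<Sum>y\<in>cube n. (\<Sum>x\<in>cube n. f x * (-1) ^ dot x y)\<^sup>2) = 2 ^ n * (\<Sum>x\<in>cube n. (f x :: real)\<^sup>2)"
proof (induction n arbitrary: f)
  case 0
  then show ?case by (simp add: cube_def dot_def)
next
  case (Suc n)
  have parallelogram: "(- u + v)\<^sup>2 + (u + v)\<^sup>2 = 2 * (u\<^sup>2 + v\<^sup>2)" for u v :: real
    by (simp add: power2_eq_square algebra_simps)
  let ?A = "\<lambda>b y. \<Sum>x\<in>cube n. f (b # x) * (-1) ^ dot x y"
  have "(\<Sum>y\<in>cube (Suc n). (\<Sum>x\<in>cube (Suc n). f x * (-1) ^ dot x y)\<^sup>2) =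
      (\<Sum>y\<in>cube n. (- ?A True y + ?A False y)\<^sup>2) + (\<Sum>y\<in>cube n. (?A True y + ?A False y)\<^sup>2)"
    by (simp add: sum_cube_Suc dot_Cons sum_negf)
  also have "\<dots> = (\<Sum>y\<in>cube n. 2 * ((?A True y)\<^sup>2 + (?A False y)\<^sup>2))"
    by (subst sum.distrib[symmetric]) (simp only: parallelogram)
  also have "\<dots> = 2 * ((\<Sum>y\<in>cube n. (?A True y)\<^sup>2) + (\<Sum>y\<in>cube n. (?A False y)\<^sup>2))"
    by (simp only: sum_distrib_left[symmetric] sum.distrib)
  also have "\<dots> = 2 ^ Suc n * (\<Sum>x\<in>cube (Suc n). (f x)\<^sup>2)"
    by (simp add: Suc sum_cube_Suc algebra_simps)
  finally show ?case .
qed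

lemma sum_fourier_mass:
  assumes "f \<in> boolean_functions n"
  shows "(\<Sum>y\<in>cube n. fourier_mass n f y) = 1"
proof -
  have "(f x)\<^sup>2 = 1" if "x \<in> cube n" for x
    using assms that by (auto simp: boolean_functions_def dest!: PiE_mem)
  then have "(\<Sum>y\<in>cube n. (\<Sum>x\<in>cube n. f x * (-1) ^ dot x y)\<^sup>2) = 2 ^ n * 2 ^ n"
    by (simp add: sum_square_character_sums card_cube)
  then show ?thesis
    by (simp add: fourier_mass_def fourier_coeff_def power_divide sum_divide_distrib[symmetric]
        power2_eq_square)
qed

section \<open>An exact algorithm\<close>

text \<open>The table \<open>g\<close> collects the answers along a path, and \<open>h\<close> turns
  the completed table into an output.\<close>

primrec learning_tree ::
  "'q list \<Rightarrow> ('q \<Rightarrow> real) \<Rightarrow> (('q \<Rightarrow> real) \<Rightarrow> 'r) \<Rightarrow> ('q, 'r) dtree" where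
  "learning_tree [] g h = Output (h g)"
| "learning_tree (x # xs) g h =
    Query x (learning_tree xs (g(x := -1)) h) (learning_tree xs (g(x := 1)) h)"

lemma run_learning_tree:
  assumes "f \<in> sign_extensions (set xs) g"
  shows "run (learning_tree xs g h) f = h f"
  using assms
proof (induction xs arbitrary: g)
  case (Cons x xs)
  then have "f \<in> sign_extensions (set xs) (g(x := f x))" "f x = 1 \<or> f x = -1"
    by (auto simp: sign_extensions_def)
  then show ?case using Cons.IH by auto
qed simp

lemma num_queries_learning_tree [simp]: "num_queries (learning_tree xs g h) f = length xs"
  by (induction xs arbitrary: g) auto

lemma query_points_learning_tree [simp]: "query_points (learning_tree xs g h) = set xs"
  by (induction xs arbitrary: g) auto

lemma output_values_learning_tree: "output_values (learning_tree xs g h) \<subseteq> range h"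
  by (induction xs arbitrary: g) auto

text \<open>Shows that the minimum defining the complexity is over a nonempty set. All randomness is
  drawn in advance: for every \<open>f\<close> independently an output \<open>h f\<close> from
  \<open>D_f\<close>. The tree for \<open>h\<close> then learns \<open>f\<close> and returns
  \<open>h f\<close>.\<close>

lemma exact_fourier_sampling:
  "\<exists>A. randomized_algorithm n A \<and> solves_fourier_sampling 0 n A \<and> makes_at_most n A (2 ^ n)"
proof -
  \<comment> \<open>The Fourier mass sums to 1 over the cube only, hence the cutoff for lists of
    other lengths.\<close>
  define F where "F f y = (if y \<in> cube n then fourier_mass n f y else 0)" for f y
  define P where "P f = embed_pmf (F f)" for f
  have pmf_P: "pmf (P f) = F f" if "f \<in> boolean_functions n" for f
  proof -
    have nonneg: "F f y \<ge> 0" for y by (simp add: F_def fourier_mass_def)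
    have "(\<integral>\<^sup>+ y. ennreal (F f y) \<partial>count_space UNIV) = (\<Sum>y\<in>cube n. ennreal (F f y))"
      by (rule nn_integral_count_space') (auto simp: F_def)
    also have "\<dots> = ennreal (\<Sum>y\<in>cube n. F f y)" using nonneg by simp
    also have "(\<Sum>y\<in>cube n. F f y) = 1" using sum_fourier_mass[OF that] by (simp add: F_def)
    finally show ?thesis
      unfolding P_def using nonneg by (intro ext pmf_embed_pmf) auto
  qed
  have set_P: "set_pmf (P f) \<subseteq> cube n" if "f \<in> boolean_functions n" for f
    by (auto simp: set_pmf_eq pmf_P[OF that] F_def split: if_splits)
  have fin: "finite (boolean_functions n)"
    by (simp add: boolean_functions_eq_sign_extensions)
  \<comment> \<open>The default value of \<open>h\<close> off \<open>boolean_functions n\<close>; it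
    lies in the cube so that every leaf outputs a point of the cube.\<close>
  define z where "z = replicate n False"
  have z: "z \<in> cube n" by (simp add: z_def cube_def)
  obtain xs where xs: "set xs = cube n" "distinct xs"
    using finite_distinct_list[OF finite_cube] by blast
  define L :: "((bool list \<Rightarrow> real) \<Rightarrow> bool list) \<Rightarrow> (bool list, bool list) dtree"
    where "L = learning_tree xs (\<lambda>_. undefined)"
  define H where "H = Pi_pmf (boolean_functions n) z P"
  define A where "A = map_pmf L H"
  have range: "range h \<subseteq> cube n" if "h \<in> set_pmf H" for h
  proof -
    have "h \<in> PiE_dflt (boolean_functions n) z (set_pmf \<circ> P)"
      using that unfolding H_def by (rule subsetD[OF set_Pi_pmf_subset'[OF fin]])
    then have "h f \<in> cube n" for f
      using set_P[of f] z by (cases "f \<in> boolean_functions n") (auto simp: PiE_dflt_def)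
    then show ?thesis by blast
  qed
  have "output_dist A f = P f" if f: "f \<in> boolean_functions n" for f
  proof -
    have "output_dist A f = map_pmf (\<lambda>h. h f) H"
      using f unfolding output_dist_def A_def map_pmf_comp
      by (simp add: L_def run_learning_tree xs boolean_functions_eq_sign_extensions)
    then show ?thesis using f fin by (simp add: H_def Pi_pmf_component)
  qed
  then have "solves_fourier_sampling 0 n A"
    by (auto simp: solves_fourier_sampling_def tv_dist_def pmf_P F_def)
  moreover have "randomized_algorithm n A"
    using range output_values_learning_tree
    by (fastforce simp: randomized_algorithm_def A_def L_def xs)
  moreover have "makes_at_most n A (2 ^ n)"
    using distinct_card[OF xs(2)] by (auto simp: makes_at_most_def A_def L_def xs card_cube)
  ultimately show ?thesis by blast
qed

section \<open>The lower bound\<close>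

text \<open>Truncating at 4 gives a bounded test function, which total variation distance controls.
  A quadratic minorant of \<open>min z 4\<close> reduces the bound to the exact fourth and sixth
  moments.\<close>

lemma sum_truncated_moment_ge:
  fixes a :: "'a \<Rightarrow> real"
  assumes "finite X" "\<And>x. x \<in> X \<Longrightarrow> \<bar>a x\<bar> = 1" and card: "card X \<ge> 4"
  defines "m \<equiv> real (card X)"
  shows "(\<Sum>f\<in>sign_extensions X f0.
      (\<Sum>x\<in>X. f x * a x)\<^sup>2 / m * min ((\<Sum>x\<in>X. f x * a x)\<^sup>2 / m) 4) \<ge> 2 ^ card X * (25 / 16)"
proof -
  have m: "m \<ge> 4" using card by (simp add: m_def)
  let ?T = "\<lambda>f. \<Sum>x\<in>X. f x * a x"
  have "2 ^ card X * (25 / 16) \<le>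
      2 ^ card X * ((3 * m\<^sup>2 - 2 * m) / m\<^sup>2 - (15 * m ^ 3 - 30 * m\<^sup>2 + 16 * m) / (16 * m ^ 3))"
  proof (rule mult_left_mono)
    \<comment> \<open>For \<open>m \<ge> 4\<close> the moments contribute at least
      \<open>5 / 2\<close> and at most \<open>15 / 16\<close>, with difference
      \<open>25 / 16\<close>.\<close>
    have "(3 * m\<^sup>2 - 2 * m) / m\<^sup>2 = 3 - 2 / m" using m by (simp add: power2_eq_square field_simps)
    moreover have "2 / m \<le> 1 / 2" using m by (simp add: field_simps)
    moreover have "(15 * m ^ 3 - 30 * m\<^sup>2 + 16 * m) / (16 * m ^ 3) \<le> 15 / 16"
    proof -
      have "16 * m \<le> 30 * m\<^sup>2" using m by (simp add: power2_eq_square)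
      then show ?thesis using m by (simp add: field_simps)
    qed
    ultimately show "25 / 16 \<le>
        (3 * m\<^sup>2 - 2 * m) / m\<^sup>2 - (15 * m ^ 3 - 30 * m\<^sup>2 + 16 * m) / (16 * m ^ 3)"
      by linarith
  qed simp
  also have "\<dots> = (\<Sum>f\<in>sign_extensions X f0. ?T f ^ 4) / m\<^sup>2
      - (\<Sum>f\<in>sign_extensions X f0. ?T f ^ 6) / (16 * m ^ 3)"
    using sign_walk_moment4[OF assms(1,2), where c = 0] sign_walk_moment6[OF assms(1,2), where c = 0]
    by (simp add: m_def right_diff_distrib)
  also have "\<dots> = (\<Sum>f\<in>sign_extensions X f0. ?T f ^ 4 / m\<^sup>2 - ?T f ^ 6 / (16 * m ^ 3))"
    by (simp add: sum_subtractf sum_divide_distrib)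
  also have "\<dots> \<le> (\<Sum>f\<in>sign_extensions X f0. (?T f)\<^sup>2 / m * min ((?T f)\<^sup>2 / m) 4)"
  proof (rule sum_mono)
    fix f
    \<comment> \<open>The parabola \<open>z - z^2 / 16\<close> has its maximum 4 at
      \<open>z = 8\<close> and lies below the line \<open>z\<close>.\<close>
    have min: "min z 4 \<ge> z - z\<^sup>2 / 16" for z :: real
      using zero_le_power2[of "z - 8"] by (simp add: min_def power2_eq_square algebra_simps)
    have "?T f ^ 4 / m\<^sup>2 - ?T f ^ 6 / (16 * m ^ 3) =
        (?T f)\<^sup>2 / m * ((?T f)\<^sup>2 / m - ((?T f)\<^sup>2 / m)\<^sup>2 / 16)"
      using m by (simp add: field_simps power_numeral_reduce)
    also have "\<dots> \<le> (?T f)\<^sup>2 / m * min ((?T f)\<^sup>2 / m) 4"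
      using m by (intro mult_left_mono min) auto
    finally show "?T f ^ 4 / m\<^sup>2 - ?T f ^ 6 / (16 * m ^ 3) \<le>
        (?T f)\<^sup>2 / m * min ((?T f)\<^sup>2 / m) 4" .
  qed
  finally show ?thesis .
qed

text \<open>The potential bound with \<open>\<tau> = 2 * n\<close>. Unrevealed signs contribute
  \<open>N\<close>, the threshold term \<open>K = N / 12\<close>, and the exponential term at most
  \<open>2 * K\<close>, in total \<open>5 / 4 * N\<close>.\<close>

lemma sum_square_run_cube_le:
  assumes "n \<ge> 1" "output_values t \<subseteq> cube n"
    and "\<And>f. f \<in> boolean_functions n \<Longrightarrow> num_queries t f \<le> q"
    and q: "real q \<le> 2 ^ n / (24 * real n)"
  shows "(\<Sum>f\<in>boolean_functions n. (\<Sum>x\<in>cube n. f x * (-1) ^ dot x (run t f))\<^sup>2) \<le>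
    2 ^ 2 ^ n * (2 ^ n * (5 / 4))"
proof -
  define N :: real where "N = 2 ^ n"
  define Q where "Q = N / (24 * real n)"
  \<comment> \<open>Chosen so that \<open>Q\<close> queries multiply the potential by at most
    \<open>exp n\<close>; the factor 24 in \<open>Q\<close> then makes \<open>K\<close> equal to
    \<open>N / 12\<close>.\<close>
  define \<theta> where "\<theta> = sqrt (2 * real n / Q)"
  define K where "K = (2 * real n)\<^sup>2 / \<theta>\<^sup>2"
  define \<kappa> where "\<kappa> = 2 * K * exp (- (2 * real n))"
  have N: "N > 0" by (simp add: N_def)
  have Q: "Q > 0" using assms(1) by (simp add: Q_def N_def)
  have \<theta>: "\<theta> > 0" "\<theta>\<^sup>2 = 2 * real n / Q" using Q assms(1) by (auto simp: \<theta>_def)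
  have K: "K = N / 12"
    unfolding K_def \<theta>(2) using assms(1) N by (simp add: Q_def power2_eq_square)
  have le_cosh: "s\<^sup>2 \<le> K + \<kappa> * cosh (\<theta> * s)" for s
    using square_le_cosh[OF \<theta>(1), of "2 * real n" s] assms(1) by (simp add: K_def \<kappa>_def)
  have growth: "exp (\<theta>\<^sup>2 / 2) ^ q \<le> exp (real n)"
  proof -
    have "real q * (\<theta>\<^sup>2 / 2) = real q / Q * real n" by (simp add: \<theta>(2))
    also have "\<dots> \<le> 1 * real n"
    proof (rule mult_right_mono)
      have "real q \<le> Q" using q by (simp only: Q_def N_def)
      then show "real q / Q \<le> 1" using Q by (simp only: divide_le_eq_1_pos)
    qed simp
    finally have "exp (real q * (\<theta>\<^sup>2 / 2)) \<le> exp (real n)" by simp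
    then show ?thesis by (simp only: exp_of_nat_mult)
  qed
  have "N \<le> exp 1 ^ n" unfolding N_def using exp_ge_add_one_self[of 1] by (intro power_mono) auto
  then have N_le: "N \<le> exp (real n)" by (simp add: exp_of_nat_mult[symmetric])
  have "(\<Sum>f\<in>boolean_functions n. (\<Sum>x\<in>cube n. f x * (-1) ^ dot x (run t f))\<^sup>2) \<le>
    2 ^ card (cube n) * (real (card (cube n)) + K + \<kappa> * (exp (\<theta>\<^sup>2 / 2) ^ q *
      (\<Sum>y\<in>cube n. cosh (\<theta> * (\<Sum>x\<in>cube n - cube n. undefined * (-1) ^ dot x y)))))"
    unfolding boolean_functions_eq_sign_extensions
  proof (rule sum_square_run_le)
    show "\<kappa> \<ge> 0" using N by (simp add: \<kappa>_def K)
  qed (use assms le_cosh in \<open>simp_all add: boolean_functions_eq_sign_extensions\<close>)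
  \<comment> \<open>Nothing is revealed at the start, so every \<open>cosh\<close> is 1 and the
    potential is \<open>N\<close>.\<close>
  also have "\<dots> = 2 ^ 2 ^ n * (N + K + \<kappa> * (exp (\<theta>\<^sup>2 / 2) ^ q * N))"
    by (simp add: card_cube N_def)
  also have "\<dots> \<le> 2 ^ 2 ^ n * (N + K + \<kappa> * (exp (real n) * exp (real n)))"
    using growth N_le N by (intro mult_left_mono add_left_mono mult_mono) (auto simp: \<kappa>_def K)
  \<comment> \<open>The initial size and the growth are each at most \<open>exp n\<close>, which the
    factor \<open>exp (- 2 * n)\<close> in \<open>\<kappa>\<close> cancels.\<close>
  also have "\<kappa> * (exp (real n) * exp (real n)) = 2 * K"
    using exp_add[of "real n" "real n"] by (simp add: \<kappa>_def exp_minus field_simps)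
  finally show ?thesis by (simp add: K N_def)
qed

text \<open>The two expectations of \<open>g\<close> differ by at most \<open>b\<close> times the l1
  distance, which is twice the total variation distance.\<close>

lemma fourier_mass_expectation_le:
  assumes "randomized_algorithm n A" "solves_fourier_sampling \<epsilon> n A" "f \<in> boolean_functions n"
    and g: "\<And>y. 0 \<le> g y" "\<And>y. g y \<le> b"
  shows "(\<Sum>y\<in>cube n. fourier_mass n f y * g y) \<le>
    measure_pmf.expectation A (\<lambda>t. g (run t f)) + 2 * \<epsilon> * b"
proof -
  let ?p = "pmf (output_dist A f)"
  have "measure_pmf.expectation A (\<lambda>t. g (run t f)) = measure_pmf.expectation (output_dist A f) g"
    by (simp add: output_dist_def)
  also have "\<dots> = (\<Sum>y\<in>cube n. g y * ?p y)"
  proof (rule integral_measure_pmf_real)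
    fix y assume "y \<in> set_pmf (output_dist A f)"
    then obtain t where "t \<in> set_pmf A" "y = run t f" by (auto simp: output_dist_def)
    then show "y \<in> cube n"
      using assms(1) run_in_output_values[of t f] by (auto simp: randomized_algorithm_def)
  qed simp
  finally have E: "measure_pmf.expectation A (\<lambda>t. g (run t f)) = (\<Sum>y\<in>cube n. g y * ?p y)" .
  have "(\<Sum>y\<in>cube n. fourier_mass n f y * g y) - (\<Sum>y\<in>cube n. g y * ?p y) =
      (\<Sum>y\<in>cube n. (fourier_mass n f y - ?p y) * g y)"
    by (simp add: sum_subtractf[symmetric] algebra_simps)
  also have "\<dots> \<le> (\<Sum>y\<in>cube n. \<bar>?p y - fourier_mass n f y\<bar> * b)"
  proof (rule sum_mono)
    fix y
    have "(fourier_mass n f y - ?p y) * g y \<le> \<bar>?p y - fourier_mass n f y\<bar> * g y"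
      using g by (intro mult_right_mono) auto
    also have "\<dots> \<le> \<bar>?p y - fourier_mass n f y\<bar> * b" using g by (intro mult_left_mono) auto
    finally show "(fourier_mass n f y - ?p y) * g y \<le> \<bar>?p y - fourier_mass n f y\<bar> * b" .
  qed
  also have "\<dots> = 2 * tv_dist n ?p (fourier_mass n f) * b"
    by (simp add: tv_dist_def sum_distrib_right)
  also have "\<dots> \<le> 2 * \<epsilon> * b"
  proof (rule mult_right_mono)
    show "b \<ge> 0" using g[of undefined] by linarith
  qed (use assms(2,3) in \<open>auto simp: solves_fourier_sampling_def\<close>)
  finally show ?thesis by (simp add: E)
qed

text \<open>The truncated square \<open>g\<close> of the normalized sum at the output is averaged
  over all \<open>f\<close>. Exact sampling gives at least \<open>25 / 16\<close>, few queries at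
  most \<open>5 / 4\<close>, and the sampling error accounts for only \<open>0.08\<close>.\<close>

lemma fourier_sampling_queries_gt:
  assumes "n \<ge> 2" "randomized_algorithm n A" "solves_fourier_sampling 0.01 n A"
    and "makes_at_most n A q"
  shows "real q > 2 ^ n / (24 * real n)"
proof (rule ccontr)
  assume "\<not> real q > 2 ^ n / (24 * real n)"
  then have q: "real q \<le> 2 ^ n / (24 * real n)" by simp
  define N :: real where "N = 2 ^ n"
  have N: "N > 0" by (simp add: N_def)
  have N4: "card (cube n) \<ge> 4"
    using power_increasing[OF assms(1), of "2::nat"] by (simp add: card_cube)
  define T where "T f y = (\<Sum>x\<in>cube n. f x * (-1) ^ dot x y)" for f :: "bool list \<Rightarrow> real" and y
  define g where "g f y = min ((T f y)\<^sup>2 / N) 4" for f y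
  have g: "0 \<le> g f y" "g f y \<le> 4" for f y using N by (auto simp: g_def)
  let ?B = "boolean_functions n"
  \<comment> \<open>The moment bound holds at each \<open>y\<close>; averaging it over the
    \<open>N\<close> points turns the weights \<open>(T f y)\<^sup>2 / N\<close> into Fourier
    mass.\<close>
  have "2 ^ 2 ^ n * (25 / 16) = (\<Sum>y\<in>cube n. 1 / N * (2 ^ 2 ^ n * (25 / 16)))"
    using N by (simp add: card_cube N_def)
  also have "\<dots> \<le> (\<Sum>y\<in>cube n. 1 / N * (\<Sum>f\<in>?B. (T f y)\<^sup>2 / N * g f y))"
  proof (intro sum_mono mult_left_mono)
    fix y
    show "2 ^ 2 ^ n * (25 / 16) \<le> (\<Sum>f\<in>?B. (T f y)\<^sup>2 / N * g f y)"
      using sum_truncated_moment_ge[OF finite_cube _ N4, of "\<lambda>x. (-1) ^ dot x y" "\<lambda>_. undefined"]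
      by (simp add: boolean_functions_eq_sign_extensions T_def g_def N_def card_cube)
  qed (use N in auto)
  also have "\<dots> = (\<Sum>y\<in>cube n. \<Sum>f\<in>?B. fourier_mass n f y * g f y)"
    using N by (simp add: sum_distrib_left fourier_mass_def fourier_coeff_def T_def[symmetric]
        N_def[symmetric] power2_eq_square mult_ac)
  also have "\<dots> = (\<Sum>f\<in>?B. \<Sum>y\<in>cube n. fourier_mass n f y * g f y)" by (rule sum.swap)
  also have "\<dots> \<le> (\<Sum>f\<in>?B. measure_pmf.expectation A (\<lambda>t. g f (run t f)) + 2 * 0.01 * 4)"
    by (intro sum_mono fourier_mass_expectation_le assms g)
  also have "\<dots> = (\<Sum>f\<in>?B. measure_pmf.expectation A (\<lambda>t. g f (run t f))) + 2 ^ 2 ^ n * 0.08"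
    by (simp add: sum.distrib boolean_functions_eq_sign_extensions card_sign_extensions card_cube)
  \<comment> \<open>Yao's principle: exchanging the average over \<open>f\<close> with the
    expectation over trees leaves a bound for each deterministic tree.\<close>
  also have "(\<Sum>f\<in>?B. measure_pmf.expectation A (\<lambda>t. g f (run t f))) =
      measure_pmf.expectation A (\<lambda>t. \<Sum>f\<in>?B. g f (run t f))"
    by (subst Bochner_Integration.integral_sum)
      (auto intro!: measure_pmf.integrable_const_bound[where B = 4] simp: g)
  also have "\<dots> \<le> 2 ^ 2 ^ n * (5 / 4)"
  proof (rule measure_pmf.integral_le_const)
    show "integrable (measure_pmf A) (\<lambda>t. \<Sum>f\<in>?B. g f (run t f))"
      by (intro Bochner_Integration.integrable_sum measure_pmf.integrable_const_bound[where B = 4])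
        (auto simp: g)
    show "AE t in measure_pmf A. (\<Sum>f\<in>?B. g f (run t f)) \<le> 2 ^ 2 ^ n * (5 / 4)"
    proof (rule AE_pmfI)
      fix t assume t: "t \<in> set_pmf A"
      have "(\<Sum>f\<in>?B. g f (run t f)) \<le> (\<Sum>f\<in>?B. (T f (run t f))\<^sup>2 / N)"
        by (intro sum_mono) (simp add: g_def)
      also have "\<dots> = (\<Sum>f\<in>?B. (T f (run t f))\<^sup>2) / N" by (simp add: sum_divide_distrib)
      also have "\<dots> \<le> 2 ^ 2 ^ n * (N * (5 / 4)) / N"
        unfolding T_def N_def using assms t q
        by (intro divide_right_mono sum_square_run_cube_le)
          (auto simp: randomized_algorithm_def makes_at_most_def)
      finally show "(\<Sum>f\<in>?B. g f (run t f)) \<le> 2 ^ 2 ^ n * (5 / 4)" using N by simp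
    qed
  qed
  finally have "(2::real) ^ 2 ^ n * (25 / 16) \<le> 2 ^ 2 ^ n * (5 / 4 + 0.08)"
    by (simp add: algebra_simps)
  then have "25 / 16 \<le> (5 / 4 + 0.08 :: real)"
    by (simp only: mult_le_cancel_left_pos zero_less_power zero_less_numeral)
  then show False by simp
qed

theorem theorem27:
  "(\<lambda>n. real (fourier_sampling_complexity 0.01 n)) \<in> \<Omega>(\<lambda>n. 2 ^ n / log 2 (2 ^ n))"
\<comment> \<open>The constant is that of the query bound, as
  \<open>log 2 (2 ^ n) = n\<close>.\<close>
proof (rule landau_omega.bigI[of "1 / 24"])
  show "\<forall>\<^sub>F n in sequentially. norm (real (fourier_sampling_complexity 0.01 n)) \<ge>
      1 / 24 * norm (2 ^ n / log 2 (2 ^ n) :: real)"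
    using eventually_ge_at_top[of 2]
  proof eventually_elim
    case (elim n)
    let ?P = "\<lambda>q. \<exists>A. randomized_algorithm n A \<and> solves_fourier_sampling 0.01 n A \<and>
      makes_at_most n A q"
    \<comment> \<open>Without a witness \<open>LEAST\<close> would be unspecified; error 0 is in
      particular at most \<open>0.01\<close>.\<close>
    have "?P (2 ^ n)"
      using exact_fourier_sampling[of n] by (fastforce simp: solves_fourier_sampling_def)
    then have "?P (fourier_sampling_complexity 0.01 n)"
      unfolding fourier_sampling_complexity_def by (rule LeastI)
    then have "2 ^ n / (24 * real n) < real (fourier_sampling_complexity 0.01 n)"
      using fourier_sampling_queries_gt[OF elim] by blast
    then show ?case by (simp add: log_nat_power)
  qed
qed simp

end
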